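(* There is a decremental recognition algorithm for PCA graphs in which only vertex removals are allowed: starting from a PCA graph with its representation, when a vertex $v$ is removed it updates the representation of the new graph in $O(d(v))$ time, where $d(v)$ is the degree of $v$ in the graph before the removal. That is, the decision takes $O(1)$ time per removed edge.
   Context: A graph is a proper circular-arc (PCA) graph if it is the intersection graph of a family of arcs of a circle in which no arc is properly contained in another arc. In the decremental dynamic recognition problem for a graph class, the input is a graph together with a sequence of updates that only decrease its size (here: removal of a vertex together with all its incident edges); the algorithm must maintain a representation of the current graph while it belongs to the class and report when an update makes the graph leave the class. *)

theory Defs
  imports
    "HOL-Analysis.Complex_Transcendental"
    "HOL-Library.Disjoint_Sets"
    "Graph_Theory.Graph_Theory"
begin

section \<open>Graphs\<close>

text \<open>
  A finite simple graph is a \<^locale>\<open>pair_graph\<close>: every edge is present as two opposite pairs in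
  \<^const>\<open>parcs\<close>, so that \<^const>\<open>out_degree\<close> is the usual degree.
\<close>

definition remove_vertex :: "'a pair_pre_digraph \<Rightarrow> 'a \<Rightarrow> 'a pair_pre_digraph" where
  "remove_vertex G v =
     \<lparr> pverts = pverts G - {v}, parcs = {e \<in> parcs G. fst e \<noteq> v \<and> snd e \<noteq> v} \<rparr>"

lemma with_proj_remove_vertex:
  "with_proj (remove_vertex G v) = pre_digraph.del_vert (with_proj G) v"
  by (simp add: remove_vertex_def pre_digraph.del_vert_def with_proj_def)

definition neighbours :: "'a pair_pre_digraph \<Rightarrow> 'a \<Rightarrow> 'a set" where
  "neighbours G v = {u. (v, u) \<in> parcs G}"


section \<open>Proper circular-arc graphs\<close>

text \<open>
  The circle is the unit circle of the complex plane.  The closed arc running counterclockwise from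
  \<open>s\<close> to \<open>t\<close> consists of the points \<open>z\<close> whose counterclockwise angle \<open>Arg2pi (z / s)\<close> from \<open>s\<close> is at
  most that of \<open>t\<close>.  The complete circle is not an arc; in a family without proper containments it
  could only occur if all members were equal to it, so this does not affect the graph class.
\<close>

definition arc_between :: "complex \<Rightarrow> complex \<Rightarrow> complex set" where
  "arc_between s t = {z \<in> sphere 0 1. Arg2pi (z / s) \<le> Arg2pi (t / s)}"

definition circular_arc :: "complex set \<Rightarrow> bool" where
  "circular_arc A \<longleftrightarrow> (\<exists>s \<in> sphere 0 1. \<exists>t \<in> sphere 0 1. s \<noteq> t \<and> A = arc_between s t)"

definition pca_model :: "'a pair_pre_digraph \<Rightarrow> ('a \<Rightarrow> complex set) \<Rightarrow> bool" where
  "pca_model G A \<longleftrightarrow>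
     (\<forall>v \<in> pverts G. circular_arc (A v)) \<and>
     (\<forall>u \<in> pverts G. \<forall>v \<in> pverts G. \<not> A u \<subset> A v) \<and>
     (\<forall>u \<in> pverts G. \<forall>v \<in> pverts G. u \<noteq> v \<longrightarrow> ((u, v) \<in> parcs G \<longleftrightarrow> A u \<inter> A v \<noteq> {}))"

definition pca_graph :: "'a pair_pre_digraph \<Rightarrow> bool" where
  "pca_graph G \<longleftrightarrow> pair_graph G \<and> (\<exists>A. pca_model G A)"


section \<open>A uniform-cost random access machine\<close>

text \<open>
  Registers and memory words hold natural numbers.  Arithmetic only adds or subtracts constants of
  the program, so one step creates no number exceeding the existing ones by more than a
  constant, and charging one time unit per instruction is legitimate.
\<close>

datatype instr =
    Const nat nat            \<comment> \<open>\<open>Const r k\<close>: \<open>r := k\<close>\<close>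
  | Add nat nat nat          \<comment> \<open>\<open>Add r q k\<close>: \<open>r := q + k\<close>\<close>
  | Sub nat nat nat          \<comment> \<open>\<open>Sub r q k\<close>: \<open>r := q - k\<close>, truncated at 0\<close>
  | Load nat nat nat         \<comment> \<open>\<open>Load r q k\<close>: \<open>r := mem[q + k]\<close>\<close>
  | Store nat nat nat        \<comment> \<open>\<open>Store q k r\<close>: \<open>mem[q + k] := r\<close>\<close>
  | If_Eq nat nat nat        \<comment> \<open>\<open>If_Eq r q l\<close>: jump to \<open>l\<close> if \<open>r = q\<close>\<close>
  | If_Less nat nat nat      \<comment> \<open>\<open>If_Less r q l\<close>: jump to \<open>l\<close> if \<open>r < q\<close>\<close>

type_synonym program = "instr list"

record machine =
  pc :: nat
  reg :: "nat \<Rightarrow> nat"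
  mem :: "nat \<Rightarrow> nat"

fun exec_instr :: "instr \<Rightarrow> machine \<Rightarrow> machine" where
  "exec_instr (Const r k) \<sigma> = \<sigma>\<lparr> pc := Suc (pc \<sigma>), reg := (reg \<sigma>)(r := k) \<rparr>"
| "exec_instr (Add r q k) \<sigma> = \<sigma>\<lparr> pc := Suc (pc \<sigma>), reg := (reg \<sigma>)(r := reg \<sigma> q + k) \<rparr>"
| "exec_instr (Sub r q k) \<sigma> = \<sigma>\<lparr> pc := Suc (pc \<sigma>), reg := (reg \<sigma>)(r := reg \<sigma> q - k) \<rparr>"
| "exec_instr (Load r q k) \<sigma> =
     \<sigma>\<lparr> pc := Suc (pc \<sigma>), reg := (reg \<sigma>)(r := mem \<sigma> (reg \<sigma> q + k)) \<rparr>"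
| "exec_instr (Store q k r) \<sigma> =
     \<sigma>\<lparr> pc := Suc (pc \<sigma>), mem := (mem \<sigma>)(reg \<sigma> q + k := reg \<sigma> r) \<rparr>"
| "exec_instr (If_Eq r q l) \<sigma> = \<sigma>\<lparr> pc := (if reg \<sigma> r = reg \<sigma> q then l else Suc (pc \<sigma>)) \<rparr>"
| "exec_instr (If_Less r q l) \<sigma> = \<sigma>\<lparr> pc := (if reg \<sigma> r < reg \<sigma> q then l else Suc (pc \<sigma>)) \<rparr>"

text \<open>The machine has halted when the program counter has left the program.\<close>

definition step :: "program \<Rightarrow> machine \<Rightarrow> machine" where
  "step P \<sigma> = (if pc \<sigma> < length P then exec_instr (P ! pc \<sigma>) \<sigma> else \<sigma>)"

definition halts_within :: "program \<Rightarrow> nat \<Rightarrow> machine \<Rightarrow> machine \<Rightarrow> bool" where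
  "halts_within P T \<sigma> \<sigma>' \<longleftrightarrow> (\<exists>k \<le> T. \<sigma>' = (step P ^^ k) \<sigma> \<and> length P \<le> pc \<sigma>')"


section \<open>Decremental recognition under vertex removals\<close>

text \<open>
  A removal request restarts the program with the handle \<open>loc v\<close> of the vertex in register 0.  The
  answer is left in register 0: 1 if the graph is still in the class \<open>cls\<close>, 0 if it has left it.
  Registers and memory persist between requests.  \<open>stores loc G m\<close> says that the memory \<open>m\<close> holds
  the graph \<open>G\<close> together with a representation of it, and \<open>T d\<close> is the time allowed for removing
  a vertex whose degree before the removal is \<open>d\<close>.
\<close>

definition request :: "nat \<Rightarrow> machine \<Rightarrow> machine" where
  "request a \<sigma> = \<sigma>\<lparr> pc := 0, reg := (reg \<sigma>)(0 := a) \<rparr>"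

fun serves_removals ::
  "(nat pair_pre_digraph \<Rightarrow> bool) \<Rightarrow> ((nat \<Rightarrow> nat) \<Rightarrow> nat pair_pre_digraph \<Rightarrow> (nat \<Rightarrow> nat) \<Rightarrow> bool) \<Rightarrow>
   program \<Rightarrow> (nat \<Rightarrow> nat) \<Rightarrow> (nat \<Rightarrow> nat) \<Rightarrow> nat pair_pre_digraph \<Rightarrow> machine \<Rightarrow> nat list \<Rightarrow> bool"
where
  "serves_removals cls stores P T loc G \<sigma> [] \<longleftrightarrow> True"
| "serves_removals cls stores P T loc G \<sigma> (v # vs) \<longleftrightarrow>
     (\<exists>\<sigma>'. halts_within P (T (out_degree (with_proj G) v)) (request (loc v) \<sigma>) \<sigma>' \<and>
        (if cls (remove_vertex G v)
         then reg \<sigma>' 0 = 1 \<and> stores loc (remove_vertex G v) (mem \<sigma>') \<and>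
              serves_removals cls stores P T loc (remove_vertex G v) \<sigma>' vs
         else reg \<sigma>' 0 = 0))"

definition decremental_recognition ::
  "(nat pair_pre_digraph \<Rightarrow> bool) \<Rightarrow> ((nat \<Rightarrow> nat) \<Rightarrow> nat pair_pre_digraph \<Rightarrow> (nat \<Rightarrow> nat) \<Rightarrow> bool) \<Rightarrow>
   program \<Rightarrow> (nat \<Rightarrow> nat) \<Rightarrow> bool"
where
  "decremental_recognition cls stores P T \<longleftrightarrow>
     (\<forall>G loc \<sigma> vs. cls G \<and> stores loc G (mem \<sigma>) \<and> distinct vs \<and> set vs \<subseteq> pverts G \<longrightarrow>
        serves_removals cls stores P T loc G \<sigma> vs)"


section \<open>Representations of proper circular-arc graphs in memory\<close>

text \<open>
  As usual, the \<open>2n\<close> endpoints of the arcs in a representation are pairwise different; the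
  representation is then given by the counterclockwise order of the endpoints.
\<close>

datatype endpoint = Start nat | End nat

primrec owner :: "endpoint \<Rightarrow> nat" where
  "owner (Start v) = v"
| "owner (End v) = v"

primrec kind :: "endpoint \<Rightarrow> nat" where
  "kind (Start v) = 0"
| "kind (End v) = 1"

primrec point :: "(nat \<Rightarrow> complex) \<Rightarrow> (nat \<Rightarrow> complex) \<Rightarrow> endpoint \<Rightarrow> complex" where
  "point s t (Start v) = s v"
| "point s t (End v) = t v"

definition endpoints :: "nat pair_pre_digraph \<Rightarrow> endpoint set" where
  "endpoints G = Start ` pverts G \<union> End ` pverts G"

definition pca_representation ::
  "nat pair_pre_digraph \<Rightarrow> (nat \<Rightarrow> complex) \<Rightarrow> (nat \<Rightarrow> complex) \<Rightarrow> bool"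
where
  "pca_representation G s t \<longleftrightarrow>
     point s t ` endpoints G \<subseteq> sphere 0 1 \<and>
     inj_on (point s t) (endpoints G) \<and>
     pca_model G (\<lambda>v. arc_between (s v) (t v))"

definition counterclockwise :: "complex list \<Rightarrow> bool" where
  "counterclockwise ps \<longleftrightarrow>
     (\<exists>b \<in> sphere 0 1. sorted_wrt (\<lambda>p q. Arg2pi (p / b) < Arg2pi (q / b)) ps)"

text \<open>
  The memory is divided into disjoint cells of consecutive words:
    \<^item> \<open>Header\<close>, at address 0: first endpoint, last endpoint;
    \<^item> \<open>Vertex v\<close>, at address \<open>loc v\<close>: start of its arc, end of its arc, first dart, last dart;
    \<^item> \<open>Endpoint e\<close>: successor, predecessor, kind, vertex;
    \<^item> \<open>Dart u v\<close>, the entry for \<open>v\<close> in the adjacency list of \<open>u\<close>: successor, predecessor,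
      the vertex \<open>v\<close>, the opposite dart \<open>Dart v u\<close>.
  Hence the words 2 and 3 of \<open>Vertex v\<close> serve as the header of the adjacency list of \<open>v\<close>.
\<close>

datatype cell = Header | Vertex nat | Endpoint endpoint | Dart nat nat

primrec cell_size :: "cell \<Rightarrow> nat" where
  "cell_size Header = 2"
| "cell_size (Vertex v) = 4"
| "cell_size (Endpoint e) = 4"
| "cell_size (Dart u v) = 4"

definition cells :: "nat pair_pre_digraph \<Rightarrow> cell set" where
  "cells G = {Header} \<union> Vertex ` pverts G \<union> Endpoint ` endpoints G \<union> (\<lambda>(u, v). Dart u v) ` parcs G"

definition layout :: "(nat \<Rightarrow> nat) \<Rightarrow> nat pair_pre_digraph \<Rightarrow> (cell \<Rightarrow> nat) \<Rightarrow> bool" where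
  "layout loc G addr \<longleftrightarrow>
     addr Header = 0 \<and> (\<forall>v \<in> pverts G. addr (Vertex v) = loc v) \<and>
     disjoint_family_on (\<lambda>x. {addr x ..< addr x + cell_size x}) (cells G)"

text \<open>
  A circular doubly linked list with nodes at the addresses \<open>ps\<close>; the first word of a node points to
  the successor, the second one to the predecessor.
\<close>

definition circular_list :: "(nat \<Rightarrow> nat) \<Rightarrow> nat list \<Rightarrow> bool" where
  "circular_list m ps \<longleftrightarrow>
     (\<forall>i < length ps. m (ps ! i) = ps ! (Suc i mod length ps) \<and>
                      m (ps ! (Suc i mod length ps) + 1) = ps ! i)"

definition stores_model :: "(nat \<Rightarrow> nat) \<Rightarrow> nat pair_pre_digraph \<Rightarrow> (cell \<Rightarrow> nat) \<Rightarrow> bool" where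
  "stores_model m G addr \<longleftrightarrow>
     (\<exists>s t es. pca_representation G s t \<and>
        distinct es \<and> set es = endpoints G \<and> counterclockwise (map (point s t) es) \<and>
        circular_list m (addr Header # map (\<lambda>e. addr (Endpoint e)) es)) \<and>
     (\<forall>e \<in> endpoints G. m (addr (Endpoint e) + 2) = kind e \<and>
                        m (addr (Endpoint e) + 3) = addr (Vertex (owner e))) \<and>
     (\<forall>v \<in> pverts G. m (addr (Vertex v)) = addr (Endpoint (Start v)) \<and>
                     m (addr (Vertex v) + 1) = addr (Endpoint (End v)))"

definition stores_adjacency :: "(nat \<Rightarrow> nat) \<Rightarrow> nat pair_pre_digraph \<Rightarrow> (cell \<Rightarrow> nat) \<Rightarrow> bool" where
  "stores_adjacency m G addr \<longleftrightarrow>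
     (\<forall>v \<in> pverts G. \<exists>us. distinct us \<and> set us = neighbours G v \<and>
        circular_list m ((addr (Vertex v) + 2) # map (\<lambda>u. addr (Dart v u)) us)) \<and>
     (\<forall>(u, v) \<in> parcs G. m (addr (Dart u v) + 2) = addr (Vertex v) \<and>
                         m (addr (Dart u v) + 3) = addr (Dart v u))"

definition stores_pca :: "(nat \<Rightarrow> nat) \<Rightarrow> nat pair_pre_digraph \<Rightarrow> (nat \<Rightarrow> nat) \<Rightarrow> bool" where
  "stores_pca loc G m \<longleftrightarrow>
     (\<exists>addr. layout loc G addr \<and> stores_model m G addr \<and> stores_adjacency m G addr)"

end

theory Submission
  imports Defs
begin

text \<open>
  Proper circular-arc graphs are hereditary: restricting a representation to the remaining vertices
  represents the remaining graph, so the answer is always 1 and only the data structure has to be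
  updated.  The two endpoints of the removed arc are unlinked from the circular endpoint list, and
  for each neighbour \<open>u\<close> of \<open>v\<close> the dart from \<open>u\<close> to \<open>v\<close>, found through the opposite-dart pointer, is
  unlinked from the adjacency list of \<open>u\<close>.  Each unlinking takes constant time, and since all lists
  are made of disjoint memory words, it does not disturb the other lists.
\<close>

section \<open>Unlinking nodes of circular lists\<close>

text \<open>Both pointers of \<open>p\<close> are read from the old memory, just as the program
  loads them into registers before its two stores.\<close>

definition unlink :: "(nat \<Rightarrow> nat) \<Rightarrow> nat \<Rightarrow> nat \<Rightarrow> nat" where
  "unlink m p = (let m' = m(m (p + 1) := m p) in m'(m p + 1 := m (p + 1)))"

text \<open>Repeating the head at the end replaces indices modulo the length by plain adjacency, so
  that a list can be cut at any node with \<open>successively_append_iff\<close>.\<close>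

lemma circular_list_Cons:
  "circular_list m (h # ps) \<longleftrightarrow> successively (\<lambda>p q. m p = q \<and> m (Suc q) = p) (h # ps @ [h])"
proof -
  have 1: "(h # ps @ [h]) ! i = (h # ps) ! i" if "i < length (h # ps)" for i
    using that nth_append[of "h # ps" "[h]" i] by simp
  have 2: "(h # ps @ [h]) ! Suc i = (h # ps) ! (Suc i mod length (h # ps))"
    if "i < length (h # ps)" for i
    using that by (cases "i = length ps") (auto simp: nth_append)
  have "Suc i < length (h # ps @ [h]) \<longleftrightarrow> i < length (h # ps)" for i
    by simp
  then show ?thesis
    unfolding circular_list_def successively_conv_nth
    by (intro all_cong1) (use 1 2 in \<open>simp del: nth_Cons_Suc list.size append.simps\<close>)
qed

lemma circular_list_frame:
  assumes "circular_list m ps" "\<And>p. p \<in> set ps \<Longrightarrow> m' p = m p \<and> m' (Suc p) = m (Suc p)"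
  shows "circular_list m' ps"
proof -
  have "Suc i mod length ps < length ps" if "i < length ps" for i
    using that by (intro mod_less_divisor) auto
  then show ?thesis
    using assms by (auto simp: circular_list_def)
qed

text \<open>An open segment uses neither the forward word of its last node nor the backward word of
  its first node. These are exactly the words that unlinking an adjacent node overwrites.\<close>

lemma successively_links_frame:
  assumes "successively (\<lambda>p q. m p = q \<and> m (Suc q) = p) ps"
    and "\<And>p. p \<in> set (butlast ps) \<Longrightarrow> m' p = m p"
    and "\<And>p. p \<in> set (tl ps) \<Longrightarrow> m' (Suc p) = m (Suc p)"
  shows "successively (\<lambda>p q. m' p = q \<and> m' (Suc q) = p) ps"
  using assms
proof (induction ps rule: induct_list012)
  case (3 p q ps)
  have "m' r = m r" if "r \<in> set (butlast (q # ps))" for r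
    using 3(4)[of r] that by simp
  moreover have "m' (Suc r) = m (Suc r)" if "r \<in> set ps" for r
    using 3(5)[of r] that by simp
  ultimately have "successively (\<lambda>p q. m' p = q \<and> m' (Suc q) = p) (q # ps)"
    using 3 by simp
  then show ?case
    using 3(3) 3(4)[of p] 3(5)[of q] by simp
qed auto

lemma circular_list_pointers:
  assumes "circular_list m (h # ps @ p # qs)"
  shows "m p = hd (qs @ [h])" "m (Suc p) = last (h # ps)"
proof -
  have "successively (\<lambda>p q. m p = q \<and> m (Suc q) = p) ((h # ps) @ p # qs @ [h])"
    using assms by (simp add: circular_list_Cons)
  then show "m p = hd (qs @ [h])" "m (Suc p) = last (h # ps)"
    unfolding successively_append_iff successively_Cons[of _ p] by simp_all
qed

text \<open>Cutting the closed list at \<open>p\<close> leaves a segment from \<open>h\<close> to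
  the predecessor of \<open>p\<close> and one from the successor of \<open>p\<close> back to
  \<open>h\<close>. The two writes touch no link inside either segment and create the link that
  joins them.\<close>

lemma circular_list_unlink:
  assumes m: "circular_list m (h # ps @ p # qs)"
    and distinct: "distinct (h # ps @ p # qs)"
    and apart: "\<And>a b. a \<in> set (h # ps @ p # qs) \<Longrightarrow> b \<in> set (h # ps @ p # qs) \<Longrightarrow> a \<noteq> Suc b"
  shows "circular_list (unlink m p) (h # ps @ qs)"
proof -
  \<comment> \<open>Either one may be the header: \<open>x = h\<close> if \<open>ps\<close> is
    empty, \<open>y = h\<close> if \<open>qs\<close> is empty.\<close>
  define x y where "x = last (h # ps)" and "y = hd (qs @ [h])"
  have unlink: "unlink m p = m(x := y, Suc y := x)"
    using circular_list_pointers[OF m] by (simp add: unlink_def x_def y_def Let_def)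
  let ?R = "\<lambda>m p q. m p = q \<and> m (Suc q) = p"
  have x: "x \<in> set (h # ps)" and y: "y \<in> set (qs @ [h])"
    unfolding x_def y_def by (rule last_in_set, simp) (rule hd_in_set, simp)
  have "successively (?R m) ((h # ps) @ p # qs @ [h])"
    using m by (simp add: circular_list_Cons)
  then have parts: "successively (?R m) (h # ps)" "successively (?R m) (qs @ [h])"
    by (auto simp: successively_append_iff successively_Cons)
  have butlast: "x \<notin> set (butlast (h # ps))"
  proof -
    have "distinct (butlast (h # ps) @ [last (h # ps)])"
      using distinct by (subst append_butlast_last_id) auto
    then show ?thesis by (simp add: x_def)
  qed
  have "successively (?R (unlink m p)) (h # ps)"
  proof (rule successively_links_frame[OF parts(1)])
    fix a assume "a \<in> set (butlast (h # ps))"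
    then show "unlink m p a = m a"
      using butlast apart[of a y] y by (auto simp: unlink dest: in_set_butlastD split: if_splits)
  next
    fix a assume a: "a \<in> set (tl (h # ps))"
    then have "a \<noteq> y" using distinct y by auto
    then show "unlink m p (Suc a) = m (Suc a)"
      using apart[of x a] a x by (auto simp: unlink)
  qed
  moreover have "successively (?R (unlink m p)) (qs @ [h])"
  proof (rule successively_links_frame[OF parts(2)])
    fix a assume "a \<in> set (butlast (qs @ [h]))"
    then have a: "a \<in> set qs" by simp
    then have "a \<noteq> x" using distinct x by auto
    then show "unlink m p a = m a"
      using apart[of a y] a y by (auto simp: unlink)
  next
    fix a assume a: "a \<in> set (tl (qs @ [h]))"
    have "distinct (qs @ [h])" using distinct by auto
    then have "a \<noteq> y" using a by (cases qs) (auto simp: y_def)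
    moreover have "a \<in> set (h # ps @ p # qs)"
      using a by (cases qs) auto
    ultimately show "unlink m p (Suc a) = m (Suc a)"
      using apart[of x a] x by (auto simp: unlink)
  qed
  \<comment> \<open>As \<open>x \<noteq> Suc y\<close>, the second write does not destroy the
    first.\<close>
  moreover have "?R (unlink m p) x y"
    using apart[of x y] x y by (auto simp: unlink)
  ultimately have "successively (?R (unlink m p)) ((h # ps) @ qs @ [h])"
    unfolding successively_append_iff by (auto simp: x_def y_def)
  then show ?thesis
    by (simp add: circular_list_Cons)
qed

section \<open>Families of disjoint circular lists in one memory\<close>

text \<open>Nodes are abstract and \<open>f\<close> gives their addresses, so that removal is
  filtering by node. By \<open>inj\<close> and \<open>apart\<close>, distinct nodes share no pointer
  word.\<close>

locale pointer_lists =
  fixes f :: "'c \<Rightarrow> nat" and S :: "'c set" and Ls :: "'c list set"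
  assumes inj: "inj_on f S"
    and nodes: "\<And>cs. cs \<in> Ls \<Longrightarrow> set cs \<subseteq> S"
    and apart: "\<And>c d. c \<in> S \<Longrightarrow> d \<in> S \<Longrightarrow> f c \<noteq> Suc (f d)"
    and distinct: "\<And>cs. cs \<in> Ls \<Longrightarrow> distinct cs"
    and disjoint: "\<And>cs ds. cs \<in> Ls \<Longrightarrow> ds \<in> Ls \<Longrightarrow> cs \<noteq> ds \<Longrightarrow> set cs \<inter> set ds = {}"
begin

text \<open>
  \<open>removed m R m'\<close>: the memory \<open>m'\<close> arises from \<open>m\<close> by taking the nodes of \<open>R\<close> out of their
  lists; only pointer words may have changed.
\<close>

definition removed :: "(nat \<Rightarrow> nat) \<Rightarrow> 'c set \<Rightarrow> (nat \<Rightarrow> nat) \<Rightarrow> bool" where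
  "removed m R m' \<longleftrightarrow>
     (\<forall>cs \<in> Ls. circular_list m' (map f (filter (\<lambda>c. c \<notin> R) cs))) \<and>
     (\<forall>a. (\<forall>c \<in> S. a \<noteq> f c \<and> a \<noteq> Suc (f c)) \<longrightarrow> m' a = m a)"

text \<open>In the list of \<open>p\<close> this is \<open>circular_list_unlink\<close>, with the
  head \<open>h\<close> still present. Both writes hit pointer words of nodes of that list, hence
  neither the other lists nor any data word.\<close>

lemma removed_unlink:
  assumes m': "removed m R m'" and cs: "h # cs \<in> Ls" "h \<notin> R" "p \<in> set cs" "p \<notin> R"
  shows "removed m (insert p R) (unlink m' (f p))"
proof -
  obtain ps qs where pq: "cs = ps @ p # qs"
    using split_list[OF cs(3)] by blast
  define as bs where "as = filter (\<lambda>c. c \<notin> R) ps" and "bs = filter (\<lambda>c. c \<notin> R) qs"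
  have dist: "distinct (h # ps @ p # qs)"
    using distinct[OF cs(1)] pq by simp
  have "filter (\<lambda>c. c \<notin> R) (h # cs) = h # as @ p # bs"
    using cs pq by (simp add: as_def bs_def)
  then have list: "circular_list m' (f h # map f as @ f p # map f bs)"
    using m' cs(1) unfolding removed_def by fastforce
  have "set (h # as @ p # bs) \<subseteq> set (h # cs)"
    by (auto simp: as_def bs_def pq)
  then have sub: "set (h # as @ p # bs) \<subseteq> S"
    using nodes[OF cs(1)] by (rule order_trans)
  have "distinct (map f (h # as @ p # bs))"
    unfolding distinct_map using dist inj_on_subset[OF inj sub] by (auto simp: as_def bs_def)
  then have "distinct (f h # map f as @ f p # map f bs)" by simp
  moreover have "a \<noteq> Suc b"
    if "a \<in> set (f h # map f as @ f p # map f bs)" "b \<in> set (f h # map f as @ f p # map f bs)" for a b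
  proof -
    have "set (f h # map f as @ f p # map f bs) = f ` set (h # as @ p # bs)"
      by auto
    then have "a \<in> f ` S" "b \<in> f ` S"
      using that image_mono[OF sub, of f] by (simp_all only: subset_iff)
    then show ?thesis using apart by auto
  qed
  ultimately have new: "circular_list (unlink m' (f p)) (f h # map f as @ map f bs)"
    using circular_list_unlink[OF list] by blast
  have "(\<lambda>c. c \<notin> insert p R) = (\<lambda>c. c \<noteq> p \<and> c \<notin> R)" by auto
  moreover have "filter (\<lambda>c. c \<noteq> p \<and> c \<notin> R) ps = as" "filter (\<lambda>c. c \<noteq> p \<and> c \<notin> R) qs = bs"
    unfolding as_def bs_def using dist by (auto intro!: filter_cong)
  ultimately have "filter (\<lambda>c. c \<notin> insert p R) (h # cs) = h # as @ bs"
    using dist cs(2) pq by auto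
  then have own: "circular_list (unlink m' (f p)) (map f (filter (\<lambda>c. c \<notin> insert p R) (h # cs)))"
    using new by simp
  \<comment> \<open>The current neighbours of \<open>p\<close> are named as nodes, so that the two
    written words can be compared with those of nodes in other lists.\<close>
  obtain x y where xy: "x \<in> set (h # cs)" "y \<in> set (h # cs)" "m' (f p) = f y" "m' (Suc (f p)) = f x"
  proof
    show "last (h # as) \<in> set (h # cs)" "hd (bs @ [h]) \<in> set (h # cs)"
      using last_in_set[of "h # as"] hd_in_set[of "bs @ [h]"] by (auto simp: as_def bs_def pq)
    have "hd (map f bs @ [f h]) = f (hd (bs @ [h]))"
      by (cases bs) auto
    then show "m' (f p) = f (hd (bs @ [h]))" "m' (Suc (f p)) = f (last (h # as))"
      using circular_list_pointers[OF list] by (auto simp: last_map)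
  qed
  have unlink: "unlink m' (f p) = m'(f x := f y, Suc (f y) := f x)"
    using xy by (simp add: unlink_def Let_def)
  have other: "circular_list (unlink m' (f p)) (map f (filter (\<lambda>c. c \<notin> insert p R) ds))"
    if ds: "ds \<in> Ls" "ds \<noteq> h # cs" for ds
  proof -
    have disj: "set ds \<inter> set (h # cs) = {}" using disjoint ds cs(1) by blast
    then have "filter (\<lambda>c. c \<notin> insert p R) ds = filter (\<lambda>c. c \<notin> R) ds"
      using cs(3) by (intro filter_cong) auto
    moreover have "circular_list (unlink m' (f p)) (map f (filter (\<lambda>c. c \<notin> R) ds))"
    proof (rule circular_list_frame)
      show "circular_list m' (map f (filter (\<lambda>c. c \<notin> R) ds))"
        using m' ds unfolding removed_def by blast
      fix a assume "a \<in> set (map f (filter (\<lambda>c. c \<notin> R) ds))"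
      then obtain c where c: "a = f c" "c \<in> set ds" by auto
      have U: "x \<in> S" "y \<in> S" "c \<in> S"
        using xy(1,2) c(2) nodes[OF ds(1)] nodes[OF cs(1)] by blast+
      have "c \<noteq> x" "c \<noteq> y" using disj c xy by auto
      then have "f c \<noteq> f x" "f c \<noteq> f y"
        using U inj unfolding inj_on_def by blast+
      moreover have "f c \<noteq> Suc (f y)" "f x \<noteq> Suc (f c)"
        using U apart by blast+
      ultimately show "unlink m' (f p) a = m' a \<and> unlink m' (f p) (Suc a) = m' (Suc a)"
        unfolding unlink c by auto
    qed
    ultimately show ?thesis by simp
  qed
  have "unlink m' (f p) a = m a" if "\<forall>c \<in> S. a \<noteq> f c \<and> a \<noteq> Suc (f c)" for a
  proof -
    have "a \<noteq> f x" "a \<noteq> Suc (f y)" using that xy(1,2) nodes[OF cs(1)] by blast+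
    then show ?thesis using that m' by (auto simp: unlink removed_def)
  qed
  then show ?thesis
    using own other unfolding removed_def by blast
qed

end

section \<open>The program\<close>

text \<open>
  Register 0 holds the handle of the vertex.  Instructions 0--4 and 5--9 unlink the two endpoints of
  its arc, instructions 12--19 walk through its adjacency list with register 1 as the current dart
  until the list header (register 4) is met again, unlinking the opposite darts; the list itself
  remains intact and is abandoned.
\<close>

definition removal_program :: program where
  "removal_program =
    [Load 1 0 0, Load 2 1 0, Load 3 1 1, Store 3 0 2, Store 2 1 3,
     Load 1 0 1, Load 2 1 0, Load 3 1 1, Store 3 0 2, Store 2 1 3,
     Add 4 0 2, Load 1 0 2,
     If_Eq 1 4 20,
     Load 5 1 3, Load 2 5 0, Load 3 5 1, Store 3 0 2, Store 2 1 3,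
     Load 1 1 0, If_Eq 0 0 12,
     Const 0 1]"

section \<open>Symbolic execution of the program\<close>

text \<open>Peeling off the first step lets \<open>simp\<close> run a literal number of instructions
  forward from a known program counter.\<close>

lemma funpow_numeral: "(f ^^ numeral k) x = (f ^^ pred_numeral k) (f x)"
  by (simp add: numeral_eq_Suc funpow_swap1)

text \<open>The address of the second endpoint is fetched only after the first has been unlinked,
  hence from \<open>m\<close> rather than from \<open>mem \<sigma>\<close>. Likewise register 1 gets
  the first dart from the final memory.\<close>

lemma run_arc:
  assumes "pc \<sigma> = 0"
  defines "\<sigma>' \<equiv> (step removal_program ^^ 12) \<sigma>"
  defines "m \<equiv> unlink (mem \<sigma>) (mem \<sigma> (reg \<sigma> 0))"
  shows "pc \<sigma>' = 12" "mem \<sigma>' = unlink m (m (reg \<sigma> 0 + 1))"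
    "reg \<sigma>' 4 = reg \<sigma> 0 + 2" "reg \<sigma>' 1 = mem \<sigma>' (reg \<sigma> 0 + 2)"
  unfolding \<sigma>'_def m_def using assms(1)
  by (simp_all add: funpow_numeral step_def removal_program_def unlink_def Let_def)

lemma run_dart:
  assumes "pc \<sigma> = 12" "reg \<sigma> 1 \<noteq> reg \<sigma> 4"
  defines "\<sigma>' \<equiv> (step removal_program ^^ 8) \<sigma>"
  shows "pc \<sigma>' = 12" "mem \<sigma>' = unlink (mem \<sigma>) (mem \<sigma> (reg \<sigma> 1 + 3))"
    "reg \<sigma>' 4 = reg \<sigma> 4" "reg \<sigma>' 1 = mem \<sigma>' (reg \<sigma> 1)"
  unfolding \<sigma>'_def using assms(1,2)
  by (simp_all add: funpow_numeral step_def removal_program_def unlink_def Let_def)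

lemma run_end:
  assumes "pc \<sigma> = 12" "reg \<sigma> 1 = reg \<sigma> 4"
  defines "\<sigma>' \<equiv> (step removal_program ^^ 2) \<sigma>"
  shows "pc \<sigma>' = length removal_program" "mem \<sigma>' = mem \<sigma>" "reg \<sigma>' 0 = 1"
  unfolding \<sigma>'_def using assms(1,2)
  by (simp_all add: funpow_numeral step_def removal_program_def)

text \<open>The loop invariant: the darts \<open>cs\<close> are done and \<open>ds\<close> remain.
  The traversed list loses no node, so its links stay valid; the opposite darts are found in data
  words that no unlinking changes; injectivity of \<open>opp\<close> ensures that each is unlinked
  once.\<close>

lemma (in pointer_lists) run_darts:
  assumes "pc \<sigma> = 12" "reg \<sigma> 4 = f h" "reg \<sigma> 1 = hd (map f ds @ [f h])"
    and "h # cs @ ds \<in> Ls" "set (h # cs @ ds) \<inter> (R \<union> opp ` set (cs @ ds)) = {}"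
    and "removed m (R \<union> opp ` set cs) (mem \<sigma>)"
    and "\<And>d. d \<in> set ds \<Longrightarrow> m (f d + 3) = f (opp d)"
    and "\<And>c d. c \<in> S \<Longrightarrow> d \<in> set ds \<Longrightarrow> f d + 3 \<noteq> f c \<and> f d + 3 \<noteq> Suc (f c)"
    and "\<And>d. d \<in> set ds \<Longrightarrow>
           \<exists>g bs. g # bs \<in> Ls \<and> opp d \<in> set bs \<and> g \<notin> R \<union> opp ` set (cs @ ds)"
    and "inj_on opp (set (cs @ ds))" "R \<inter> opp ` set ds = {}"
  shows "\<exists>\<sigma>'. (step removal_program ^^ (8 * length ds)) \<sigma> = \<sigma>' \<and> pc \<sigma>' = 12 \<and>
           reg \<sigma>' 1 = reg \<sigma>' 4 \<and> removed m (R \<union> opp ` set (cs @ ds)) (mem \<sigma>')"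
  using assms
proof (induction ds arbitrary: cs \<sigma>)
  case (Cons d ds)
  note prems = Cons.prems
  define \<sigma>' where "\<sigma>' = (step removal_program ^^ 8) \<sigma>"
  have "distinct (h # cs @ d # ds)" "set (h # cs @ d # ds) \<subseteq> S"
    using distinct[OF prems(4)] nodes[OF prems(4)] by auto
  then have "f d \<noteq> f h" "d \<notin> set cs \<union> set ds"
    using inj_onD[OF inj, of d h] by auto
  then have "reg \<sigma> 1 \<noteq> reg \<sigma> 4" and d: "reg \<sigma> 1 = f d"
    using prems(2,3) by auto
  note dart = run_dart[OF prems(1) this(1), folded \<sigma>'_def]
  \<comment> \<open>This word is no pointer word, so the frame clause of \<open>removed\<close>
    applies.\<close>
  have "mem \<sigma> (f d + 3) = m (f d + 3)"
    using prems(6) prems(8)[of _ d] unfolding removed_def by simp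
  then have mem: "mem \<sigma>' = unlink (mem \<sigma>) (f (opp d))"
    using dart(2) d prems(7)[of d] by simp
  obtain g bs where g: "g # bs \<in> Ls" "opp d \<in> set bs" "g \<notin> R \<union> opp ` set (cs @ d # ds)"
    using prems(9)[of d] by auto
  have "opp d \<notin> opp ` set cs"
    using prems(10) \<open>d \<notin> set cs \<union> set ds\<close> by (auto simp: inj_on_def)
  then have "opp d \<notin> R \<union> opp ` set cs"
    using prems(11) by auto
  then have "removed m (insert (opp d) (R \<union> opp ` set cs)) (mem \<sigma>')"
    unfolding mem using g by (intro removed_unlink[OF prems(6) g(1) _ g(2)]) auto
  then have rem: "removed m (R \<union> opp ` set (cs @ [d])) (mem \<sigma>')"
    by simp
  \<comment> \<open>The traversed list avoids all removed nodes, so its filtered version is the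
    whole list and \<open>d\<close> still points to the next dart or to the header.\<close>
  have "filter (\<lambda>c. c \<notin> R \<union> opp ` set (cs @ [d])) (h # cs @ d # ds) = h # cs @ d # ds"
    using prems(5) by (intro filter_True) auto
  then have "circular_list (mem \<sigma>') (map f (h # cs @ d # ds))"
    using rem prems(4) unfolding removed_def by metis
  then have "mem \<sigma>' (f d) = hd (map f ds @ [f h])"
    by (intro circular_list_pointers) simp
  then have "\<exists>\<sigma>''. (step removal_program ^^ (8 * length ds)) \<sigma>' = \<sigma>'' \<and> pc \<sigma>'' = 12 \<and>
      reg \<sigma>'' 1 = reg \<sigma>'' 4 \<and> removed m (R \<union> opp ` set ((cs @ [d]) @ ds)) (mem \<sigma>'')"
    using prems dart d rem by (intro Cons.IH) (simp_all del: Un_insert_right Un_insert_left)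
  moreover have "(step removal_program ^^ (8 * length (d # ds))) \<sigma>
      = (step removal_program ^^ (8 * length ds)) \<sigma>'"
  proof -
    have "8 * length (d # ds) = 8 * length ds + 8" by simp
    then show ?thesis by (simp only: funpow_add o_apply \<sigma>'_def)
  qed
  ultimately show ?case
    by simp
qed auto

section \<open>The stored graph\<close>

text \<open>
  A vertex takes part in its adjacency list with its words 2 and 3, every other cell in its list
  with its words 0 and 1.
\<close>

definition node_address :: "(cell \<Rightarrow> nat) \<Rightarrow> cell \<Rightarrow> nat" where
  "node_address addr c = addr c + (case c of Vertex _ \<Rightarrow> 2 | _ \<Rightarrow> 0)"

lemma node_address_simps [simp]:
  "node_address addr Header = addr Header"
  "node_address addr (Vertex v) = addr (Vertex v) + 2"
  "node_address addr (Endpoint e) = addr (Endpoint e)"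
  "node_address addr (Dart u v) = addr (Dart u v)"
  by (simp_all add: node_address_def)

lemma layout_inj:
  assumes "layout loc G addr" "c \<in> cells G" "d \<in> cells G"
    and "addr c + i = addr d + j" "i < cell_size c" "j < cell_size d"
  shows "c = d \<and> i = j"
proof -
  have "addr c + i \<in> {addr c ..< addr c + cell_size c} \<inter> {addr d ..< addr d + cell_size d}"
    using assms(4-6) by auto
  then have "c = d"
    using assms(1-3) unfolding layout_def disjoint_family_on_def by blast
  then show ?thesis using assms(4) by simp
qed

text \<open>Both pointer words fit into the cell, even into the two words of \<open>Header\<close>;
  this makes \<open>layout_inj\<close> applicable to them.\<close>

lemma node_address_offset:
  obtains k where "node_address addr c = addr c + k" "Suc k < cell_size c"
    "k = (case c of Vertex _ \<Rightarrow> 2 | _ \<Rightarrow> 0)"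
  by (rule that[of "case c of Vertex _ \<Rightarrow> 2 | _ \<Rightarrow> 0"]) (simp_all add: node_address_def split: cell.split)

definition pca_lists :: "nat pair_pre_digraph \<Rightarrow> endpoint list \<Rightarrow> (nat \<Rightarrow> nat list) \<Rightarrow> cell list set" where
  "pca_lists G es us =
     insert (Header # map Endpoint es) ((\<lambda>u. Vertex u # map (Dart u) (us u)) ` pverts G)"

text \<open>The pointer offset depends only on the cell, so a forward word equal to a backward word
  would force one cell to have offsets differing by 1. Lists are disjoint because a cell determines
  its list: endpoints and header share one, \<open>Vertex u\<close> and \<open>Dart u w\<close>
  belong to that of \<open>u\<close>.\<close>

lemma pointer_lists_pca:
  assumes layout: "layout loc G addr" and es: "distinct es" "set es = endpoints G"
    and us: "\<And>u. u \<in> pverts G \<Longrightarrow> distinct (us u) \<and> set (us u) = neighbours G u"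
  shows "pointer_lists (node_address addr) (cells G) (pca_lists G es us)"
proof
  show "inj_on (node_address addr) (cells G)"
  proof (rule inj_onI)
    fix c d assume "c \<in> cells G" "d \<in> cells G" "node_address addr c = node_address addr d"
    moreover obtain k where "node_address addr c = addr c + k" "Suc k < cell_size c"
      by (rule node_address_offset)
    moreover obtain l where "node_address addr d = addr d + l" "Suc l < cell_size d"
      by (rule node_address_offset)
    ultimately show "c = d"
      using layout_inj[OF layout, of c d k l] by simp
  qed
next
  fix c d assume cd: "c \<in> cells G" "d \<in> cells G"
  obtain k where k: "node_address addr c = addr c + k" "Suc k < cell_size c"
    "k = (case c of Vertex _ \<Rightarrow> 2 | _ \<Rightarrow> 0)"
    by (rule node_address_offset)
  obtain l where l: "node_address addr d = addr d + l" "Suc l < cell_size d"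
    "l = (case d of Vertex _ \<Rightarrow> 2 | _ \<Rightarrow> 0)"
    by (rule node_address_offset)
  show "node_address addr c \<noteq> Suc (node_address addr d)"
    using layout_inj[OF layout cd, of k "Suc l"] k l by (auto split: cell.splits)
next
  fix cs assume "cs \<in> pca_lists G es us"
  then show "set cs \<subseteq> cells G" "distinct cs"
    using es us unfolding pca_lists_def cells_def neighbours_def
    by (auto simp: distinct_map inj_on_def)
next
  fix cs ds assume "cs \<in> pca_lists G es us" "ds \<in> pca_lists G es us" "cs \<noteq> ds"
  then show "set cs \<inter> set ds = {}"
    unfolding pca_lists_def by auto
qed

section \<open>Heredity of graphs, arc models and layouts\<close>

lemma pair_graph_remove_vertex:
  assumes "pair_graph G"
  shows "pair_graph (remove_vertex G v)"
proof -
  interpret pair_graph G by fact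
  show ?thesis
    using pair_sym_arcs
    by unfold_locales
      (auto simp: remove_vertex_def symmetric_def sym_def intro: finite_subset
        dest: wellformed' pair_no_loops)
qed

lemma endpoints_remove_vertex: "endpoints (remove_vertex G v) = endpoints G - {Start v, End v}"
  by (auto simp: endpoints_def remove_vertex_def)

text \<open>The arcs are kept: every condition is universal over vertices, and adjacency between
  surviving vertices does not change.\<close>

lemma pca_model_remove_vertex: "pca_model G A \<Longrightarrow> pca_model (remove_vertex G v) A"
  by (auto simp: pca_model_def remove_vertex_def)

lemma pca_graph_remove_vertex: "pca_graph G \<Longrightarrow> pca_graph (remove_vertex G v)"
  unfolding pca_graph_def by (elim conjE exE, intro conjI exI)
    (erule pair_graph_remove_vertex, erule pca_model_remove_vertex)

lemma pca_representation_remove_vertex: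
  assumes "pca_representation G s t"
  shows "pca_representation (remove_vertex G v) s t"
proof -
  have "endpoints (remove_vertex G v) \<subseteq> endpoints G"
    by (auto simp: endpoints_remove_vertex)
  then show ?thesis
    using assms pca_model_remove_vertex inj_on_subset image_mono[of _ _ "point s t"]
    unfolding pca_representation_def by (meson order_trans)
qed

lemma cells_remove_vertex: "cells (remove_vertex G v) \<subseteq> cells G"
  by (auto simp: cells_def endpoints_def remove_vertex_def)

lemma layout_remove_vertex: "layout loc G addr \<Longrightarrow> layout loc (remove_vertex G v) addr"
  using cells_remove_vertex[of G v]
  by (auto simp: layout_def remove_vertex_def intro: disjoint_family_on_mono)

lemma neighbours_remove_vertex:
  "u \<noteq> v \<Longrightarrow> neighbours (remove_vertex G v) u = neighbours G u - {v}"
  by (auto simp: neighbours_def remove_vertex_def)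

text \<open>The same base point \<open>b\<close> serves the sublist.\<close>

lemma counterclockwise_filter:
  assumes "counterclockwise (map g es)"
  shows "counterclockwise (map g (filter Q es))"
  using assms unfolding counterclockwise_def
  by (auto simp: sorted_wrt_map intro: sorted_wrt_filter)

text \<open>With the frame clause of \<open>removed\<close>, this is why kinds, owners, arc ends and
  opposite-dart pointers survive every unlinking.\<close>

lemma data_word_not_pointer:
  assumes "layout loc G addr" "c \<in> cells G" "d \<in> cells G" "i < cell_size c"
    and "case c of Vertex _ \<Rightarrow> i < 2 | _ \<Rightarrow> 2 \<le> i"
  shows "addr c + i \<noteq> node_address addr d" "addr c + i \<noteq> Suc (node_address addr d)"
proof -
  obtain k where k: "node_address addr d = addr d + k" "Suc k < cell_size d"
    "k = (case d of Vertex _ \<Rightarrow> 2 | _ \<Rightarrow> 0)"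
    by (rule node_address_offset)
  show "addr c + i \<noteq> node_address addr d" "addr c + i \<noteq> Suc (node_address addr d)"
    using layout_inj[OF assms(1-3), of i k] layout_inj[OF assms(1-3), of i "Suc k"] k assms(4,5)
    by (auto split: cell.splits)
qed

text \<open>Only the darts towards \<open>v\<close> are listed; those leaving \<open>v\<close> form
  a list that is abandoned as a whole.\<close>

definition removed_cells :: "nat pair_pre_digraph \<Rightarrow> nat \<Rightarrow> cell set" where
  "removed_cells G v =
     {Endpoint (Start v), Endpoint (End v)} \<union> (\<lambda>u. Dart u v) ` neighbours G v"

lemma (in pair_graph) neighbours_sym: "u \<in> neighbours G v \<longleftrightarrow> v \<in> neighbours G u"
  using pair_sym_arcs by (auto simp: neighbours_def symmetric_def sym_def)

text \<open>The machine does not occur here: any memory with the right cells taken out stores the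
  smaller graph, with the same \<open>addr\<close>, \<open>s\<close> and \<open>t\<close>. The
  filtered lists supply the links and the frame clause supplies the data words.\<close>

lemma stores_pca_remove_vertex:
  assumes G: "pair_graph G"
    and layout: "layout loc G addr"
    and rep: "pca_representation G s t"
    and es: "distinct es" "set es = endpoints G" "counterclockwise (map (point s t) es)"
    and us: "\<And>u. u \<in> pverts G \<Longrightarrow> distinct (us u) \<and> set (us u) = neighbours G u"
    and endpoint: "\<And>e. e \<in> endpoints G \<Longrightarrow> m (addr (Endpoint e) + 2) = kind e \<and>
                        m (addr (Endpoint e) + 3) = addr (Vertex (owner e))"
    and vertex: "\<And>u. u \<in> pverts G \<Longrightarrow> m (addr (Vertex u)) = addr (Endpoint (Start u)) \<and>
                     m (addr (Vertex u) + 1) = addr (Endpoint (End u))"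
    and dart: "\<And>u w. (u, w) \<in> parcs G \<Longrightarrow> m (addr (Dart u w) + 2) = addr (Vertex w) \<and>
                         m (addr (Dart u w) + 3) = addr (Dart w u)"
    and removed: "pointer_lists.removed (node_address addr) (cells G) (pca_lists G es us) m
                    (removed_cells G v) m'"
  shows "stores_pca loc (remove_vertex G v) m'"
proof -
  let ?G = "remove_vertex G v" and ?R = "removed_cells G v"
  interpret pair_graph G by (fact G)
  interpret pointer_lists "node_address addr" "cells G" "pca_lists G es us"
    using layout es(1,2) us by (rule pointer_lists_pca)
  have data: "m' (addr c + i) = m (addr c + i)"
    if "c \<in> cells G" "i < cell_size c" "case c of Vertex _ \<Rightarrow> i < 2 | _ \<Rightarrow> 2 \<le> i" for c i
    using removed data_word_not_pointer[OF layout that(1) _ that(2,3)] unfolding removed_def by blast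
  have list: "circular_list m' (map (node_address addr) (filter (\<lambda>c. c \<notin> ?R) cs))"
    if "cs \<in> pca_lists G es us" for cs
    using removed that unfolding removed_def by blast
  define es' where "es' = filter (\<lambda>e. e \<notin> {Start v, End v}) es"
  have "filter (\<lambda>e. Endpoint e \<notin> ?R) es = es'"
    unfolding es'_def by (intro filter_cong) (auto simp: removed_cells_def)
  moreover have "Header \<notin> ?R"
    by (auto simp: removed_cells_def)
  ultimately have "filter (\<lambda>c. c \<notin> ?R) (Header # map Endpoint es) = Header # map Endpoint es'"
    by (simp add: filter_map o_def)
  then have "circular_list m' (addr Header # map (\<lambda>e. addr (Endpoint e)) es')"
    using list[of "Header # map Endpoint es"] by (simp add: pca_lists_def o_def)
  moreover have "distinct es'" "set es' = endpoints ?G"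
    using es unfolding es'_def by (auto simp: endpoints_remove_vertex)
  moreover have "counterclockwise (map (point s t) es')"
    unfolding es'_def using es(3) by (rule counterclockwise_filter)
  moreover have "pca_representation ?G s t"
    using rep by (rule pca_representation_remove_vertex)
  ultimately have "\<exists>s t es. pca_representation ?G s t \<and> distinct es \<and> set es = endpoints ?G \<and>
      counterclockwise (map (point s t) es) \<and>
      circular_list m' (addr Header # map (\<lambda>e. addr (Endpoint e)) es)"
    by blast
  moreover have "m' (addr (Endpoint e) + 2) = kind e \<and> m' (addr (Endpoint e) + 3) = addr (Vertex (owner e))"
    if "e \<in> endpoints ?G" for e
  proof -
    have e: "e \<in> endpoints G" using that by (simp add: endpoints_remove_vertex)
    then have "Endpoint e \<in> cells G" by (simp add: cells_def)
    then show ?thesis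
      using endpoint[OF e] data[of "Endpoint e" 2] data[of "Endpoint e" 3] by simp
  qed
  moreover have "m' (addr (Vertex u)) = addr (Endpoint (Start u)) \<and>
      m' (addr (Vertex u) + 1) = addr (Endpoint (End u))"
    if "u \<in> pverts ?G" for u
  proof -
    have u: "u \<in> pverts G" using that by (simp add: remove_vertex_def)
    then have "Vertex u \<in> cells G" by (simp add: cells_def)
    then show ?thesis
      using vertex[OF u] data[of "Vertex u" 0] data[of "Vertex u" 1] by simp
  qed
  ultimately have model: "stores_model m' ?G addr"
    unfolding stores_model_def by blast
  have "\<exists>us. distinct us \<and> set us = neighbours ?G u \<and>
      circular_list m' ((addr (Vertex u) + 2) # map (\<lambda>w. addr (Dart u w)) us)"
    if "u \<in> pverts ?G" for u
  proof (intro exI conjI)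
    have u: "u \<in> pverts G" "u \<noteq> v" using that by (auto simp: remove_vertex_def)
    show "distinct (filter (\<lambda>w. w \<noteq> v) (us u))"
      using us[OF u(1)] by simp
    show "set (filter (\<lambda>w. w \<noteq> v) (us u)) = neighbours ?G u"
      using us[OF u(1)] u(2) by (auto simp: neighbours_remove_vertex)
    \<comment> \<open>Symmetry of the graph enters here: if \<open>v\<close> occurs in the list of
      \<open>u\<close>, then \<open>u\<close> is a neighbour of \<open>v\<close>, so
      \<open>Dart u v\<close> was indeed removed.\<close>
    have "Dart u w \<in> ?R \<longleftrightarrow> w = v" if "w \<in> set (us u)" for w
      using that us[OF u(1)] neighbours_sym[of u v] by (auto simp: removed_cells_def)
    then have "filter (\<lambda>w. Dart u w \<notin> ?R) (us u) = filter (\<lambda>w. w \<noteq> v) (us u)"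
      by (intro filter_cong) auto
    moreover have "Vertex u \<notin> ?R"
      by (auto simp: removed_cells_def)
    ultimately have "filter (\<lambda>c. c \<notin> ?R) (Vertex u # map (Dart u) (us u))
        = Vertex u # map (Dart u) (filter (\<lambda>w. w \<noteq> v) (us u))"
      by (simp add: filter_map o_def)
    then show "circular_list m' ((addr (Vertex u) + 2) # map (\<lambda>w. addr (Dart u w))
        (filter (\<lambda>w. w \<noteq> v) (us u)))"
      using list[of "Vertex u # map (Dart u) (us u)"] u(1) by (simp add: pca_lists_def o_def)
  qed
  moreover have "m' (addr (Dart u w) + 2) = addr (Vertex w) \<and> m' (addr (Dart u w) + 3) = addr (Dart w u)"
    if "(u, w) \<in> parcs ?G" for u w
  proof -
    have uw: "(u, w) \<in> parcs G" using that by (simp add: remove_vertex_def)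
    then have "Dart u w \<in> cells G" by (auto simp: cells_def)
    then show ?thesis
      using dart[OF uw] data[of "Dart u w" 2] data[of "Dart u w" 3] by simp
  qed
  ultimately have "stores_adjacency m' ?G addr"
    unfolding stores_adjacency_def by blast
  then show ?thesis
    using model layout_remove_vertex[OF layout] unfolding stores_pca_def by blast
qed

section \<open>Correctness and cost of one removal\<close>

text \<open>The run takes 12 steps for the arc, 8 for each neighbour and 2 to finish; with degree
  \<open>d\<close> this is \<open>8 * d + 14 \<le> 14 * (d + 1)\<close>.\<close>

lemma serve_removal:
  assumes G: "pair_graph G" and stores: "stores_pca loc G (mem \<sigma>)" and v: "v \<in> pverts G"
  shows "\<exists>\<sigma>'. halts_within removal_program (14 * (out_degree (with_proj G) v + 1)) (request (loc v) \<sigma>) \<sigma>' \<and>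
           reg \<sigma>' 0 = 1 \<and> stores_pca loc (remove_vertex G v) (mem \<sigma>')"
proof -
  interpret pair_graph G by (fact G)
  obtain addr where layout: "layout loc G addr"
    and model: "stores_model (mem \<sigma>) G addr" and adjacency: "stores_adjacency (mem \<sigma>) G addr"
    using stores unfolding stores_pca_def by blast
  obtain s t es where rep: "pca_representation G s t"
    and es: "distinct es" "set es = endpoints G" "counterclockwise (map (point s t) es)"
    and es_list: "circular_list (mem \<sigma>) (addr Header # map (\<lambda>e. addr (Endpoint e)) es)"
    using model unfolding stores_model_def by blast
  have endpoint: "mem \<sigma> (addr (Endpoint e) + 2) = kind e \<and>
      mem \<sigma> (addr (Endpoint e) + 3) = addr (Vertex (owner e))" if "e \<in> endpoints G" for e
    using model that unfolding stores_model_def by blast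
  have vertex: "mem \<sigma> (addr (Vertex u)) = addr (Endpoint (Start u)) \<and>
      mem \<sigma> (addr (Vertex u) + 1) = addr (Endpoint (End u))" if "u \<in> pverts G" for u
    using model that unfolding stores_model_def by blast
  have dart: "mem \<sigma> (addr (Dart u w) + 2) = addr (Vertex w) \<and>
      mem \<sigma> (addr (Dart u w) + 3) = addr (Dart w u)" if "(u, w) \<in> parcs G" for u w
    using adjacency that unfolding stores_adjacency_def by blast
  have "\<forall>u \<in> pverts G. \<exists>us. distinct us \<and> set us = neighbours G u \<and>
      circular_list (mem \<sigma>) ((addr (Vertex u) + 2) # map (\<lambda>w. addr (Dart u w)) us)"
    using adjacency unfolding stores_adjacency_def by blast
  from bchoice[OF this] obtain us where us: "\<And>u. u \<in> pverts G \<Longrightarrow> distinct (us u) \<and> set (us u) = neighbours G u"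
    and us_list: "\<And>u. u \<in> pverts G \<Longrightarrow>
      circular_list (mem \<sigma>) ((addr (Vertex u) + 2) # map (\<lambda>w. addr (Dart u w)) (us u))"
    by blast
  interpret pointer_lists "node_address addr" "cells G" "pca_lists G es us"
    using layout es(1,2) us by (rule pointer_lists_pca)
  have "circular_list (mem \<sigma>) (map (node_address addr) cs)" if "cs \<in> pca_lists G es us" for cs
    using that es_list us_list by (auto simp: pca_lists_def o_def)
  then have rem0: "removed (mem \<sigma>) {} (mem \<sigma>)"
    by (simp add: removed_def)
  define \<sigma>0 where "\<sigma>0 = request (loc v) \<sigma>"
  define \<sigma>1 where "\<sigma>1 = (step removal_program ^^ 12) \<sigma>0"
  have \<sigma>0: "pc \<sigma>0 = 0" "mem \<sigma>0 = mem \<sigma>" "reg \<sigma>0 0 = addr (Vertex v)"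
    using layout v by (simp_all add: \<sigma>0_def request_def layout_def)
  note run = run_arc[OF \<sigma>0(1), folded \<sigma>1_def, unfolded \<sigma>0]
  have es_in: "Header # map Endpoint es \<in> pca_lists G es us"
    by (simp add: pca_lists_def)
  have ends: "Endpoint (Start v) \<in> set (map Endpoint es)" "Endpoint (End v) \<in> set (map Endpoint es)"
    using es(2) v by (auto simp: endpoints_def)
  let ?m = "unlink (mem \<sigma>) (node_address addr (Endpoint (Start v)))"
  have rem1: "removed (mem \<sigma>) {Endpoint (Start v)} ?m"
    using ends(1) by (intro removed_unlink[OF rem0 es_in]) auto
  have v_cell: "Vertex v \<in> cells G"
    using v by (simp add: cells_def)
  \<comment> \<open>The pointer from \<open>v\<close> to the end of its arc is a data word, so the
    second unlinking really targets \<open>End v\<close>.\<close>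
  have "?m (addr (Vertex v) + 1) = mem \<sigma> (addr (Vertex v) + 1)"
    using rem1 data_word_not_pointer[OF layout v_cell, of _ 1] unfolding removed_def by simp
  then have "mem \<sigma>1 = unlink ?m (node_address addr (Endpoint (End v)))"
    using run(2) vertex[OF v] by simp
  moreover have "removed (mem \<sigma>) {Endpoint (End v), Endpoint (Start v)}
      (unlink ?m (node_address addr (Endpoint (End v))))"
    using ends(2) by (intro removed_unlink[OF rem1 es_in]) auto
  ultimately have rem2: "removed (mem \<sigma>) {Endpoint (Start v), Endpoint (End v)} (mem \<sigma>1)"
    by (simp add: insert_commute)
  have v_in: "Vertex v # map (Dart v) (us v) \<in> pca_lists G es us"
    using v by (simp add: pca_lists_def)
  \<comment> \<open>On darts this is the cell-level meaning of the opposite-dart pointer in word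
    3.\<close>
  define opp where "opp c = (case c of Dart u w \<Rightarrow> Dart w u | _ \<Rightarrow> c)" for c
  have opp: "opp ` set (map (Dart v) (us v)) = (\<lambda>u. Dart u v) ` neighbours G v"
    using us[OF v] by (force simp: opp_def image_image)
  \<comment> \<open>Without loops, no reversed dart lies in the list of \<open>v\<close> itself,
    which therefore stays intact during its traversal.\<close>
  have loop: "v \<notin> neighbours G v"
    using pair_no_loops[of "(v, v)"] by (auto simp: neighbours_def)
  have "filter (\<lambda>c. c \<notin> {Endpoint (Start v), Endpoint (End v)}) (Vertex v # map (Dart v) (us v))
      = Vertex v # map (Dart v) (us v)"
    by (intro filter_True) auto
  then have "circular_list (mem \<sigma>1) (map (node_address addr) (Vertex v # map (Dart v) (us v)))"
    using rem2 v_in unfolding removed_def by metis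
  then have reg1: "reg \<sigma>1 1 = hd (map (node_address addr) (map (Dart v) (us v)) @ [node_address addr (Vertex v)])"
    using run(4) by (simp add: circular_list_Cons successively_Cons)
  have "\<exists>\<sigma>2. (step removal_program ^^ (8 * length (map (Dart v) (us v)))) \<sigma>1 = \<sigma>2 \<and> pc \<sigma>2 = 12 \<and>
      reg \<sigma>2 1 = reg \<sigma>2 4 \<and>
      removed (mem \<sigma>) ({Endpoint (Start v), Endpoint (End v)} \<union> opp ` set ([] @ map (Dart v) (us v))) (mem \<sigma>2)"
  proof (rule run_darts)
    show "pc \<sigma>1 = 12" "reg \<sigma>1 4 = node_address addr (Vertex v)"
      using run by simp_all
    show "reg \<sigma>1 1 = hd (map (node_address addr) (map (Dart v) (us v)) @ [node_address addr (Vertex v)])"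
      by (fact reg1)
    show "Vertex v # [] @ map (Dart v) (us v) \<in> pca_lists G es us"
      using v_in by simp
    show "set (Vertex v # [] @ map (Dart v) (us v)) \<inter>
        ({Endpoint (Start v), Endpoint (End v)} \<union> opp ` set ([] @ map (Dart v) (us v))) = {}"
      using loop opp us[OF v] by auto
    show "removed (mem \<sigma>) ({Endpoint (Start v), Endpoint (End v)} \<union> opp ` set []) (mem \<sigma>1)"
      using rem2 by simp
    show "{Endpoint (Start v), Endpoint (End v)} \<inter> opp ` set (map (Dart v) (us v)) = {}"
      unfolding opp by auto
    show "inj_on opp (set ([] @ map (Dart v) (us v)))"
      by (auto simp: inj_on_def opp_def)
  next
    fix d assume "d \<in> set (map (Dart v) (us v))"
    then obtain u where u: "d = Dart v u" "u \<in> neighbours G v"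
      using us[OF v] by auto
    then have arc: "(v, u) \<in> parcs G"
      by (simp add: neighbours_def)
    show "mem \<sigma> (node_address addr d + 3) = node_address addr (opp d)"
      using dart[OF arc] u by (simp add: opp_def)
    have u_vert: "u \<in> pverts G"
      using arc wellformed' by blast
    have "v \<in> set (us u)"
      using us[OF u_vert] u(2) neighbours_sym by blast
    then have "Vertex u # map (Dart u) (us u) \<in> pca_lists G es us \<and>
        opp d \<in> set (map (Dart u) (us u)) \<and>
        Vertex u \<notin> {Endpoint (Start v), Endpoint (End v)} \<union> opp ` set ([] @ map (Dart v) (us v))"
      using u u_vert opp by (auto simp: pca_lists_def opp_def)
    then show "\<exists>g bs. g # bs \<in> pca_lists G es us \<and> opp d \<in> set bs \<and>
        g \<notin> {Endpoint (Start v), Endpoint (End v)} \<union> opp ` set ([] @ map (Dart v) (us v))"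
      by blast
    fix c assume c: "c \<in> cells G"
    have "d \<in> cells G"
      using arc u by (auto simp: cells_def)
    then show "node_address addr d + 3 \<noteq> node_address addr c \<and>
        node_address addr d + 3 \<noteq> Suc (node_address addr c)"
      using data_word_not_pointer[OF layout _ c, of d 3] u by simp
  qed
  then obtain \<sigma>2 where \<sigma>2: "(step removal_program ^^ (8 * length (us v))) \<sigma>1 = \<sigma>2" "pc \<sigma>2 = 12"
      "reg \<sigma>2 1 = reg \<sigma>2 4" "removed (mem \<sigma>) (removed_cells G v) (mem \<sigma>2)"
    unfolding removed_cells_def using opp by auto
  define \<sigma>3 where "\<sigma>3 = (step removal_program ^^ 2) \<sigma>2"
  note finish = run_end[OF \<sigma>2(2,3), folded \<sigma>3_def]
  have "out_arcs (with_proj G) v = Pair v ` neighbours G v"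
    by (auto simp: out_arcs_def neighbours_def)
  then have "out_degree (with_proj G) v = length (us v)"
    using us[OF v] distinct_card[of "us v"] by (simp add: out_degree_def card_image inj_on_def)
  moreover have "\<sigma>3 = (step removal_program ^^ (2 + (8 * length (us v) + 12))) \<sigma>0"
    by (simp only: funpow_add o_apply \<sigma>3_def \<sigma>2(1)[symmetric] \<sigma>1_def)
  moreover have "2 + (8 * length (us v) + 12) \<le> 14 * (length (us v) + 1)"
    by simp
  ultimately have "halts_within removal_program (14 * (out_degree (with_proj G) v + 1)) \<sigma>0 \<sigma>3"
    using finish(1) unfolding halts_within_def by (metis order_refl)
  moreover have "stores_pca loc (remove_vertex G v) (mem \<sigma>3)"
    unfolding finish(2)
    by (rule stores_pca_remove_vertex[OF G layout rep es us endpoint vertex dart \<sigma>2(4)])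
  ultimately show ?thesis
    using finish(3) unfolding \<sigma>0_def by blast
qed

text \<open>By heredity only the branch with answer 1 occurs. Distinctness of the requests keeps the
  later ones inside the smaller graph, and the induction generalises over the machine since
  registers and memory persist.\<close>

lemma serves_removals_pca:
  assumes "pca_graph G" "stores_pca loc G (mem \<sigma>)" "distinct vs" "set vs \<subseteq> pverts G"
  shows "serves_removals pca_graph stores_pca removal_program (\<lambda>d. 14 * (d + 1)) loc G \<sigma> vs"
  using assms
proof (induction vs arbitrary: G \<sigma>)
  case (Cons v vs)
  then have G: "pair_graph G"
    by (simp add: pca_graph_def)
  obtain \<sigma>' where \<sigma>': "halts_within removal_program (14 * (out_degree (with_proj G) v + 1))
      (request (loc v) \<sigma>) \<sigma>'" "reg \<sigma>' 0 = 1" "stores_pca loc (remove_vertex G v) (mem \<sigma>')"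
    using serve_removal[OF G Cons.prems(2), of v] Cons.prems(4) by auto
  have G': "pca_graph (remove_vertex G v)"
    using Cons.prems(1) by (rule pca_graph_remove_vertex)
  moreover have "set vs \<subseteq> pverts (remove_vertex G v)"
    using Cons.prems(3,4) by (auto simp: remove_vertex_def)
  ultimately have "serves_removals pca_graph stores_pca removal_program (\<lambda>d. 14 * (d + 1)) loc
      (remove_vertex G v) \<sigma>' vs"
    using Cons.prems(3) \<sigma>'(3) by (intro Cons.IH) auto
  then show ?case
    using G' \<sigma>' by auto
qed simp

theorem theorem8:
  shows "\<exists>(P :: program) (c :: nat). decremental_recognition pca_graph stores_pca P (\<lambda>d. c * (d + 1))"
  \<comment> \<open>The witnesses are \<open>removal_program\<close> and \<open>c = 14\<close>; the
    bound uses \<open>d + 1\<close> because even an isolated vertex costs constant time.\<close>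
  unfolding decremental_recognition_def using serves_removals_pca by blast

end
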